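(* Let $n\geq 2$. The spectrum of the transition matrix of the "Walk or switch" Lamplighter random walk over the complete graph $K_n$, with two lamp colors, is given by $\Sigma=\bigcup_{k=0}^n\binom{n}{k}\Sigma_k$, where $$\Sigma_0=\{0\ (\text{multiplicity } n-1);\ 1\},\qquad \Sigma_n=\left\{-\frac2n\ (\text{multiplicity } n-1);\ \frac{n-2}{n}\right\},$$ and, for each $k=1,\ldots,n-1$, $$\Sigma_k=\left\{-\frac2n\ (\text{multiplicity } k-1);\ 0\ (\text{multiplicity } n-k-1);\ \frac{n-2\pm\sqrt{(n+2)^2-8k}}{2n}\right\}.$$
   Context: The "Walk or switch" Lamplighter random walk on $K_n$ with two lamp colors is the Markov chain on the state space $\{(f,v): f:V\to\{0,1\},\ v\in V\}$, where $V$ is the vertex set of $K_n$; from $(f,v)$ one of the following $n$ moves is chosen with probability $1/n$ each: move to one of the $n-1$ vertices $v'\neq v$ leaving $f$ unchanged, or stay at $v$ and switch the value $f(v)$ to $1-f(v)$, leaving all other values of $f$ unchanged. Its transition matrix has order $n2^n$; equivalently, up to ordering of the states, it is $$I_2^{\otimes n}\otimes\tfrac1n(J_n-I_n)+\sum_{i=1}^n I_2^{\otimes(i-1)}\otimes\tfrac1n\begin{pmatrix}0&1\\1&0\end{pmatrix}\otimes I_2^{\otimes(n-i)}\otimes C_i,$$ where $\otimes$ is the Kronecker product, $J_n$ is the all-ones matrix of order $n$, and $C_i\in\mathcal{M}_n(\mathbb{C})$ has entry $1$ in position $(i,i)$ and $0$ elsewhere. Spectra are multisets of eigenvalues with multiplicity;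 $\binom nk\Sigma_k$ means that each element of the multiset $\Sigma_k$ is taken with its multiplicity multiplied by $\binom nk$, and the union adds multiplicities. Elements listed without a multiplicity have multiplicity one in the list. *)

theory Defs
  imports
    Complex_Main
    "HOL-Library.FuncSet"
    "HOL-Library.Multiset"
    "Jordan_Normal_Form.Char_Poly"
begin

text \<open>States of the lamplighter chain on the complete graph with vertex set \<open>V\<close>: a lamp
  configuration \<open>V \<rightarrow> {0,1}\<close> (extensional, so that distinct functions are distinct
  configurations) and the position of the lamplighter.\<close>

type_synonym 'v lamp_state = "('v \<Rightarrow> nat) \<times> 'v"

definition lamp_states :: "'v set \<Rightarrow> 'v lamp_state set" where
  "lamp_states V = (V \<rightarrow>\<^sub>E {0, 1}) \<times> V"

definition walk_or_switch_moves :: "'v set \<Rightarrow> 'v lamp_state \<Rightarrow> 'v lamp_state set" where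
  "walk_or_switch_moves V s =
     (case s of (f, v) \<Rightarrow> {(f, v') |v'. v' \<in> V \<and> v' \<noteq> v} \<union> {(f(v := 1 - f v), v)})"

definition walk_or_switch_prob :: "'v set \<Rightarrow> 'v lamp_state \<Rightarrow> 'v lamp_state \<Rightarrow> real" where
  "walk_or_switch_prob V s t =
     (if t \<in> walk_or_switch_moves V s then 1 / real (card V) else 0)"

text \<open>The transition matrix with respect to an enumeration \<open>e\<close> of the states by
  \<open>{..<card (lamp_states V)}\<close>.\<close>

definition walk_or_switch_matrix :: "'v set \<Rightarrow> (nat \<Rightarrow> 'v lamp_state) \<Rightarrow> complex mat" where
  "walk_or_switch_matrix V e =
     mat (card (lamp_states V)) (card (lamp_states V))
       (\<lambda>(i, j). complex_of_real (walk_or_switch_prob V (e i) (e j)))"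

definition spectrum_mset :: "complex mat \<Rightarrow> complex multiset" where
  "spectrum_mset A = proots (char_poly A)"

definition Sigma_mset :: "nat \<Rightarrow> nat \<Rightarrow> real multiset" where
  "Sigma_mset n k =
     (if k = 0 then replicate_mset (n - 1) 0 + {#1#}
      else if k = n then replicate_mset (n - 1) (- 2 / real n) + {#(real n - 2) / real n#}
      else replicate_mset (k - 1) (- 2 / real n) + replicate_mset (n - k - 1) 0
         + {#(real n - 2 + sqrt ((real n + 2)\<^sup>2 - 8 * real k)) / (2 * real n),
             (real n - 2 - sqrt ((real n + 2)\<^sup>2 - 8 * real k)) / (2 * real n)#})"

lemma card_lamp_states:
  assumes "finite V"
  shows "card (lamp_states V) = card V * 2 ^ card V"
  using assms by (simp add: lamp_states_def card_cartesian_product card_PiE numeral_2_eq_2)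

lemma walk_or_switch_moves_subset:
  assumes "s \<in> lamp_states V"
  shows "walk_or_switch_moves V s \<subseteq> lamp_states V"
  using assms
  by (fastforce simp: lamp_states_def walk_or_switch_moves_def PiE_iff extensional_def)

text \<open>The moves lead to pairwise distinct states, so the transition probabilities
  defined above sum to one.\<close>

lemma card_walk_or_switch_moves:
  assumes "finite V" and "s \<in> lamp_states V"
  shows "card (walk_or_switch_moves V s) = card V"
proof -
  obtain f v where s: "s = (f, v)" and v: "v \<in> V"
    using assms(2) by (auto simp: lamp_states_def)
  have *: "walk_or_switch_moves V s = insert (f(v := 1 - f v), v) (Pair f ` (V - {v}))"
    by (auto simp: walk_or_switch_moves_def s)
  have "card (Pair f ` (V - {v})) = card (V - {v})"
    by (rule card_image) (simp add: inj_on_def)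
  moreover have "(f(v := 1 - f v), v) \<notin> Pair f ` (V - {v})" by auto
  moreover have "card V > 0" using assms(1) v by (auto simp: card_gt_0_iff)
  ultimately show ?thesis using assms(1) v by (simp add: * card_Diff_singleton)
qed

end

theory Submission
  imports Defs
begin

text \<open>The Walsh transform on the lamp configurations turns the switch at \<open>v\<close> into multiplication
  by \<open>-1\<close> or \<open>1\<close>, according to whether \<open>v\<close> lies in the set \<open>S\<close> indexing the Walsh character. The
  transition matrix thus becomes block diagonal with one block \<open>J/n - (2/n) diag 1\<^sub>S\<close> for each
  subset \<open>S\<close> of \<open>V\<close>. As a rank-one perturbation of a diagonal matrix, such a block with
  \<open>k = |S|\<close> has the characteristic polynomial
  \<open>x^(n-k) (x+2/n)^k (1 - ((n-k)/x + k/(x+2/n))/n)\<close>, whose roots are those of \<open>\<Sigma>\<^sub>k\<close>.\<close>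

section \<open>Matrices with labelled rows and columns\<close>

text \<open>Entries are given on labels (states or configurations), and positions enter only through
  enumerations. Matrix identities thereby reduce to identities of sums over the label sets.\<close>

definition indexed_mat ::
    "nat \<Rightarrow> nat \<Rightarrow> (nat \<Rightarrow> 'a) \<Rightarrow> (nat \<Rightarrow> 'b) \<Rightarrow> ('a \<Rightarrow> 'b \<Rightarrow> 'c) \<Rightarrow> 'c mat" where
  "indexed_mat m n a b F = mat m n (\<lambda>(i, j). F (a i) (b j))"

lemma indexed_mat_carrier [simp]: "indexed_mat m n a b F \<in> carrier_mat m n"
  by (simp add: indexed_mat_def)

lemma indexed_mat_index [simp]:
  "i < m \<Longrightarrow> j < n \<Longrightarrow> indexed_mat m n a b F $$ (i, j) = F (a i) (b j)"
  by (simp add: indexed_mat_def)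

lemma indexed_mat_dim [simp]:
  "dim_row (indexed_mat m n a b F) = m" "dim_col (indexed_mat m n a b F) = n"
  by (simp_all add: indexed_mat_def)

lemma indexed_mat_cong:
  assumes "bij_betw a {..<m} A" "bij_betw b {..<n} B"
    and "\<And>x y. x \<in> A \<Longrightarrow> y \<in> B \<Longrightarrow> F x y = G x y"
  shows "indexed_mat m n a b F = indexed_mat m n a b G"
  using assms by (intro eq_matI) (auto simp: bij_betw_def)

lemma indexed_mat_mult:
  fixes F :: "'a \<Rightarrow> 'b \<Rightarrow> 'd :: comm_semiring_0"
  assumes "bij_betw b {..<n} B"
  shows "indexed_mat m n a b F * indexed_mat n k b c G =
    indexed_mat m k a c (\<lambda>x z. \<Sum>y\<in>B. F x y * G y z)"
proof (rule eq_matI)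
  fix i j assume "i < dim_row (indexed_mat m k a c (\<lambda>x z. \<Sum>y\<in>B. F x y * G y z))"
    "j < dim_col (indexed_mat m k a c (\<lambda>x z. \<Sum>y\<in>B. F x y * G y z))"
  then have ij: "i < m" "j < k" by simp_all
  have "(indexed_mat m n a b F * indexed_mat n k b c G) $$ (i, j) =
      (\<Sum>l<n. F (a i) (b l) * G (b l) (c j))"
    using ij by (simp add: scalar_prod_def atLeast0LessThan)
  also have "\<dots> = (\<Sum>y\<in>B. F (a i) y * G y (c j))"
    by (rule sum.reindex_bij_betw[OF assms])
  finally show "(indexed_mat m n a b F * indexed_mat n k b c G) $$ (i, j) =
      indexed_mat m k a c (\<lambda>x z. \<Sum>y\<in>B. F x y * G y z) $$ (i, j)"
    using ij by simp
qed simp_all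

lemma indexed_mat_one:
  assumes "bij_betw a {..<n} A"
  shows "indexed_mat n n a a (\<lambda>x y. if x = y then 1 else 0) = 1\<^sub>m n"
  using assms by (intro eq_matI) (auto simp: bij_betw_def inj_on_def)

section \<open>Determinants of diagonal matrices with constant blocks subtracted\<close>

lemma det_indexed_mat_diag:
  fixes f :: "'a \<Rightarrow> 'b :: comm_ring_1"
  assumes "bij_betw a {..<n} A"
  shows "det (indexed_mat n n a a (\<lambda>x y. if x = y then f x else 0)) = (\<Prod>x\<in>A. f x)"
proof -
  let ?D = "indexed_mat n n a a (\<lambda>x y. if x = y then f x else 0)"
  have "upper_triangular ?D"
    using assms by (fastforce simp: upper_triangular_def bij_betw_def inj_on_def)
  then have "det ?D = prod_list (diag_mat ?D)"
    by (rule det_upper_triangular) (rule indexed_mat_carrier)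
  also have "\<dots> = (\<Prod>i<n. f (a i))"
    by (simp add: prod_list_diag_prod atLeast0LessThan)
  also have "\<dots> = (\<Prod>x\<in>A. f x)"
    by (rule prod.reindex_bij_betw[OF assms])
  finally show ?thesis .
qed

text \<open>Both sides are the determinant of the block matrix with rows \<open>(L, U)\<close> and \<open>(W, 1)\<close>,
  factored into block triangular matrices in two ways.\<close>

lemma det_diff_mult:
  fixes L :: "'a :: idom mat"
  assumes L: "L \<in> carrier_mat n n" "K \<in> carrier_mat n n" "L * K = 1\<^sub>m n"
    and U: "U \<in> carrier_mat n m" and W: "W \<in> carrier_mat m n"
  shows "det (L - U * W) = det L * det (1\<^sub>m m - W * (K * U))"
proof -
  let ?M = "four_block_mat L U W (1\<^sub>m m)"
  let ?S = "1\<^sub>m m - W * (K * U)"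
  have UW: "U * W \<in> carrier_mat n n" and KU: "K * U \<in> carrier_mat n m"
    and WKU: "W * (K * U) \<in> carrier_mat m m"
    using L U W by auto
  have S: "?S \<in> carrier_mat m m" using WKU by (rule minus_carrier_mat)
  have LUW: "L - U * W \<in> carrier_mat n n" using UW by (rule minus_carrier_mat)
  \<comment> \<open>The identities \<open>a1\<close> to \<open>b2\<close> evaluate the blocks of the
    two products below, as \<open>mult_four_block_mat\<close> forms them.\<close>
  have a1: "(L - U * W) * 1\<^sub>m n + U * W = L"
    unfolding right_mult_one_mat[OF LUW] using L(1) UW
    by (intro eq_matI) (auto simp del: index_mult_mat)
  have a2: "W * (K * U) + ?S = 1\<^sub>m m"
    using WKU by (intro eq_matI) (auto simp del: index_mult_mat)
  have a3: "L * (K * U) = U"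
    using L U by (simp add: assoc_mult_mat[symmetric, of _ n n _ n _ m])
  have b1: "(L - U * W) * 0\<^sub>m n m + U * 1\<^sub>m m = U" "0\<^sub>m m n * 1\<^sub>m n + 1\<^sub>m m * W = W"
    "0\<^sub>m m n * 0\<^sub>m n m + 1\<^sub>m m * 1\<^sub>m m = (1\<^sub>m m :: 'a mat)"
    using U W by (simp_all add: right_mult_zero_mat[OF LUW])
  have b2: "L * 1\<^sub>m n + 0\<^sub>m n m * 0\<^sub>m m n = L" "U + 0\<^sub>m n m * ?S = U"
    "W * 1\<^sub>m n + 1\<^sub>m m * 0\<^sub>m m n = W" "1\<^sub>m m * ?S = ?S"
    using L(1) U W S by (simp_all add: left_mult_zero_mat[OF S] left_mult_one_mat[OF S])
  have "?M = four_block_mat (L - U * W) U (0\<^sub>m m n) (1\<^sub>m m) *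
      four_block_mat (1\<^sub>m n) (0\<^sub>m n m) W (1\<^sub>m m)"
    by (simp only: mult_four_block_mat[OF LUW U zero_carrier_mat one_carrier_mat
          one_carrier_mat zero_carrier_mat W one_carrier_mat] a1 b1)
  then have "det ?M = det (four_block_mat (L - U * W) U (0\<^sub>m m n) (1\<^sub>m m)) *
      det (four_block_mat (1\<^sub>m n) (0\<^sub>m n m) W (1\<^sub>m m))"
    using LUW U W by (simp add: det_mult[of _ "n + m"])
  also have "\<dots> = det (L - U * W)"
    using LUW U W
    by (simp add: det_four_block_mat_lower_left_zero[of _ n _ m]
        det_four_block_mat_upper_right_zero[of _ n _ m])
  finally have 1: "det ?M = det (L - U * W)" .
  \<comment> \<open>The second factorization eliminates \<open>U\<close> instead of
    \<open>W\<close>. This is where \<open>K\<close> as a right inverse of \<open>L\<close> enters: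
    \<open>L * (K * U) = U\<close>.\<close>
  have "?M = four_block_mat L (0\<^sub>m n m) W (1\<^sub>m m) *
      four_block_mat (1\<^sub>m n) (K * U) (0\<^sub>m m n) ?S"
    by (simp only: mult_four_block_mat[OF L(1) zero_carrier_mat W one_carrier_mat
          one_carrier_mat KU zero_carrier_mat S] a2 a3 b2)
  then have "det ?M = det (four_block_mat L (0\<^sub>m n m) W (1\<^sub>m m)) *
      det (four_block_mat (1\<^sub>m n) (K * U) (0\<^sub>m m n) ?S)"
    using L W KU S by (simp add: det_mult[of _ "n + m"])
  also have "\<dots> = det L * det ?S"
    using L W KU S
    by (simp add: det_four_block_mat_lower_left_zero[of _ n _ m]
        det_four_block_mat_upper_right_zero[of _ n _ m])
  finally show ?thesis using 1 by simp
qed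

text \<open>The subtracted matrix factors through the block labels as \<open>U * W\<close>. By
  \<open>det_diff_mult\<close> the determinant shrinks to one of size \<open>card C\<close>, and
  that matrix is diagonal because distinct blocks do not interact.\<close>

lemma det_diag_minus_const_blocks:
  fixes l :: "'a \<Rightarrow> 'b \<Rightarrow> 'c :: field"
  assumes C: "finite C" and V: "finite V"
    and e: "bij_betw e {..<N} (C \<times> V)"
    and nz: "\<And>g u. g \<in> C \<Longrightarrow> u \<in> V \<Longrightarrow> l g u \<noteq> 0"
  shows "det (indexed_mat N N e e (\<lambda>s t. (if s = t then l (fst s) (snd s) else 0)
      - (if fst s = fst t then c else 0))) =
    (\<Prod>g\<in>C. (\<Prod>u\<in>V. l g u) * (1 - c * (\<Sum>u\<in>V. 1 / l g u)))"
proof -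
  obtain b where b: "bij_betw b {..<card C} C"
    using ex_bij_betw_nat_finite[OF C] by (auto simp: atLeast0LessThan)
  let ?m = "card C"
  define L where "L = indexed_mat N N e e (\<lambda>s t. if s = t then l (fst s) (snd s) else 0)"
  define K where "K = indexed_mat N N e e (\<lambda>s t. if s = t then 1 / l (fst s) (snd s) else 0)"
  define U where "U = indexed_mat N ?m e b (\<lambda>s g. if fst s = g then c else 0)"
  define W where "W = indexed_mat ?m N b e (\<lambda>g s. if fst s = g then 1 else (0 :: 'c))"
  have LK: "L * K = 1\<^sub>m N"
    unfolding L_def K_def indexed_mat_mult[OF e] indexed_mat_one[OF e, symmetric]
    using nz C V
    by (intro indexed_mat_cong[OF e e]) (auto simp: if_distrib[of "\<lambda>x. x * _"] sum.delta cong: if_cong)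
  have UW: "U * W = indexed_mat N N e e (\<lambda>s t. if fst s = fst t then c else 0)"
    unfolding U_def W_def indexed_mat_mult[OF b]
    using C by (intro indexed_mat_cong[OF e e]) (auto simp: if_distrib[of "\<lambda>x. x * _"] sum.delta cong: if_cong)
  have KU: "K * U = indexed_mat N ?m e b (\<lambda>s g. if fst s = g then c / l (fst s) (snd s) else 0)"
    unfolding K_def U_def indexed_mat_mult[OF e]
    using C V by (intro indexed_mat_cong[OF e b]) (auto simp: if_distrib[of "\<lambda>x. x * _"] sum.delta cong: if_cong)
  have WKU: "W * (K * U) =
      indexed_mat ?m ?m b b (\<lambda>g h. if g = h then c * (\<Sum>u\<in>V. 1 / l g u) else 0)"
    unfolding W_def KU indexed_mat_mult[OF e]
  proof (rule indexed_mat_cong[OF b b])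
    fix g h assume gh: "g \<in> C" "h \<in> C"
    have "(\<Sum>s\<in>C \<times> V. (if fst s = g then 1 else 0) * (if fst s = h then c / l (fst s) (snd s) else 0))
      = (\<Sum>g'\<in>C. if g' = g then (\<Sum>u\<in>V. if g' = h then c / l g' u else 0) else 0)"
      by (subst sum.cartesian_product') (auto intro!: sum.cong)
    also have "\<dots> = (if g = h then c * (\<Sum>u\<in>V. 1 / l g u) else 0)"
      using gh C by (simp add: sum_distrib_left)
    finally show "(\<Sum>s\<in>C \<times> V. (if fst s = g then 1 else 0) *
        (if fst s = h then c / l (fst s) (snd s) else 0)) =
      (if g = h then c * (\<Sum>u\<in>V. 1 / l g u) else 0)" .
  qed
  have S: "1\<^sub>m ?m - W * (K * U) =
      indexed_mat ?m ?m b b (\<lambda>g h. if g = h then 1 - c * (\<Sum>u\<in>V. 1 / l g u) else 0)"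
    unfolding WKU indexed_mat_one[OF b, symmetric] by (intro eq_matI) auto
  have "indexed_mat N N e e (\<lambda>s t. (if s = t then l (fst s) (snd s) else 0)
      - (if fst s = fst t then c else 0)) = L - U * W"
    unfolding UW L_def by (intro eq_matI) auto
  also have "det (L - U * W) = det L * det (1\<^sub>m ?m - W * (K * U))"
    by (rule det_diff_mult[OF _ _ LK]) (simp_all add: L_def K_def U_def W_def)
  also have "det L = (\<Prod>s\<in>C \<times> V. l (fst s) (snd s))"
    unfolding L_def by (rule det_indexed_mat_diag[OF e])
  also have "\<dots> = (\<Prod>g\<in>C. \<Prod>u\<in>V. l g u)"
    by (simp add: prod.cartesian_product split_def)
  also have "det (1\<^sub>m ?m - W * (K * U)) = (\<Prod>g\<in>C. 1 - c * (\<Sum>u\<in>V. 1 / l g u))"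
    unfolding S by (rule det_indexed_mat_diag[OF b])
  finally show ?thesis by (simp add: prod.distrib)
qed

section \<open>Walsh characters and block diagonalization\<close>

abbreviation lamp_configs :: "'v set \<Rightarrow> ('v \<Rightarrow> nat) set" where
  "lamp_configs V \<equiv> V \<rightarrow>\<^sub>E {0, 1}"

text \<open>The characters of the group of 0/1 configurations under addition mod 2. They are indexed
  by configurations rather than subsets, so that the enumeration \<open>e\<close> of the states also
  labels the transformed basis.\<close>

definition walsh :: "'v set \<Rightarrow> ('v \<Rightarrow> nat) \<Rightarrow> ('v \<Rightarrow> nat) \<Rightarrow> complex" where
  "walsh V f g = (\<Prod>u\<in>V. (- 1) ^ (f u * g u))"

text \<open>The sum over configurations factors over the vertices. The factor at \<open>u\<close> is
  \<open>1 + (-1) ^ (f u + h u)\<close>, which vanishes wherever \<open>f\<close> and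
  \<open>h\<close> differ.\<close>

lemma walsh_orthogonal:
  assumes V: "finite V" and f: "f \<in> lamp_configs V" and h: "h \<in> lamp_configs V"
  shows "(\<Sum>g\<in>lamp_configs V. walsh V f g * walsh V g h) = (if f = h then 2 ^ card V else 0)"
proof -
  have "(\<Sum>g\<in>lamp_configs V. walsh V f g * walsh V g h) =
      (\<Sum>g\<in>lamp_configs V. \<Prod>u\<in>V. (- 1) ^ (f u * g u) * (- 1) ^ (g u * h u))"
    by (simp add: walsh_def prod.distrib)
  also have "\<dots> = (\<Prod>u\<in>V. \<Sum>a\<in>{0, 1}. (- 1) ^ (f u * a) * (- 1) ^ (a * h u))"
    using V by (subst prod_sum_PiE) auto
  also have "\<dots> = (\<Prod>u\<in>V. if f u = h u then 2 else 0)"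
  proof (rule prod.cong)
    fix u assume "u \<in> V"
    then have "f u \<in> {0, 1}" "h u \<in> {0, 1}" using f h by (auto simp: PiE_iff)
    then show "(\<Sum>a\<in>{0, 1}. (- 1) ^ (f u * a) * (- 1) ^ (a * h u)) =
        (if f u = h u then 2 else (0 :: complex))" by auto
  qed simp
  also have "\<dots> = (if f = h then 2 ^ card V else 0)"
  proof (cases "f = h")
    case False
    then obtain u where "u \<in> V" "f u \<noteq> h u" using PiE_ext[OF f h] by auto
    then show ?thesis using V False by (auto intro!: prod_zero)
  qed simp
  finally show ?thesis .
qed

text \<open>Only the factor at \<open>v\<close> changes, and since \<open>f v\<close> is 0 or 1 its
  old and new exponents add up to \<open>g v\<close>.\<close>

lemma walsh_switch:
  assumes V: "finite V" "v \<in> V" and f: "f \<in> lamp_configs V"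
  shows "walsh V (f(v := 1 - f v)) g = (- 1) ^ g v * walsh V f g"
proof -
  have "f v \<in> {0, 1}" using f V by (auto simp: PiE_iff)
  then have "(- 1) ^ ((1 - f v) * g v) = (- 1) ^ g v * (- 1 :: complex) ^ (f v * g v)"
    by (auto simp flip: power_add)
  then show ?thesis
    using V by (simp add: walsh_def prod.remove[of V v])
qed

text \<open>In the Walsh basis of the lamp configurations, switching the lamp at \<open>w\<close> multiplies the
  character of \<open>h\<close> by \<open>(- 1) ^ h w\<close>, so the configuration is conserved.\<close>

definition walsh_prob :: "'v set \<Rightarrow> 'v lamp_state \<Rightarrow> 'v lamp_state \<Rightarrow> complex" where
  "walsh_prob V s t = (if fst s = fst t
     then (if snd s = snd t then (- 1) ^ fst t (snd t) else 1) / of_nat (card V) else 0)"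

text \<open>This computes one entry of the transition matrix times the Walsh transform.\<close>

lemma walk_or_switch_prob_walsh:
  assumes V: "finite V" and s: "(f, v) \<in> lamp_states V" and t: "(h, w) \<in> lamp_states V"
  shows "(\<Sum>r\<in>lamp_states V. complex_of_real (walk_or_switch_prob V (f, v) r) *
      (if snd r = w then walsh V (fst r) h else 0)) =
    (if v = w then (- 1) ^ h w else 1) / of_nat (card V) * walsh V f h"
proof -
  have fin: "finite (lamp_states V)" using V by (auto simp: lamp_states_def intro!: finite_PiE)
  \<comment> \<open>Exactly one move from \<open>(f, v)\<close> ends at position \<open>w\<close>:
    the switch if \<open>v = w\<close>, the walk to \<open>w\<close> otherwise. The sum therefore
    has a single relevant term.\<close>
  let ?r = "if v = w then (f(v := 1 - f v), v) else (f, w)"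
  have r: "?r \<in> lamp_states V"
    using s t by (auto simp: lamp_states_def PiE_iff extensional_def)
  have "(\<Sum>r\<in>lamp_states V. complex_of_real (walk_or_switch_prob V (f, v) r) *
      (if snd r = w then walsh V (fst r) h else 0)) =
    (\<Sum>r\<in>lamp_states V. if r = ?r then walsh V (fst r) h / of_nat (card V) else 0)"
    using t by (intro sum.cong)
      (auto simp: walk_or_switch_prob_def walk_or_switch_moves_def lamp_states_def)
  also have "\<dots> = walsh V (fst ?r) h / of_nat (card V)"
    using fin r by simp
  also have "\<dots> = (if v = w then (- 1) ^ h w else 1) / of_nat (card V) * walsh V f h"
    using walsh_switch[OF V, of v f h] s by (auto simp: lamp_states_def)
  finally show ?thesis .
qed

text \<open>The change of basis \<open>P\<close> is the Walsh matrix on configurations tensored with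
  the identity on positions.\<close>

lemma walk_or_switch_matrix_similar:
  assumes V: "finite V" and e: "bij_betw e {..<N} (lamp_states V)"
  shows "similar_mat (walk_or_switch_matrix V e) (indexed_mat N N e e (walsh_prob V))"
proof -
  have N: "N = card (lamp_states V)" using bij_betw_same_card[OF e] by simp
  have fin: "finite (lamp_configs V)" using V by (auto intro!: finite_PiE)
  define A where "A = walk_or_switch_matrix V e"
  have A: "A = indexed_mat N N e e (\<lambda>s t. complex_of_real (walk_or_switch_prob V s t))"
    by (simp add: A_def walk_or_switch_matrix_def indexed_mat_def N)
  define B where "B = indexed_mat N N e e (walsh_prob V)"
  define P where "P = indexed_mat N N e e
    (\<lambda>s t. if snd s = snd t then walsh V (fst s) (fst t) else 0)"
  \<comment> \<open>By orthogonality the Walsh matrix is its own inverse up to the factor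
    \<open>2 ^ card V\<close>.\<close>
  define Q where "Q = indexed_mat N N e e
    (\<lambda>s t. (if snd s = snd t then walsh V (fst s) (fst t) else 0) / 2 ^ card V)"
  \<comment> \<open>As \<open>Q\<close> is a scalar multiple of \<open>P\<close>, this one identity
    yields both \<open>P * Q = 1\<close> and \<open>Q * P = 1\<close>.\<close>
  have walsh2: "(\<Sum>r\<in>lamp_states V. (if snd s = snd r then walsh V (fst s) (fst r) else 0) *
      (if snd r = snd t then walsh V (fst r) (fst t) else 0)) = (if s = t then 2 ^ card V else 0)"
    if st: "s \<in> lamp_states V" "t \<in> lamp_states V" for s t
  proof -
    have "(\<Sum>r\<in>lamp_states V. (if snd s = snd r then walsh V (fst s) (fst r) else 0) *
      (if snd r = snd t then walsh V (fst r) (fst t) else 0)) =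
      (\<Sum>g\<in>lamp_configs V. \<Sum>u\<in>V. if u = snd s then
        if snd s = snd t then walsh V (fst s) g * walsh V g (fst t) else 0 else 0)"
      unfolding lamp_states_def
      by (subst sum.cartesian_product') (auto intro!: sum.cong)
    also have "\<dots> = (if s = t then 2 ^ card V else 0)"
    proof (cases "snd s = snd t")
      case True
      then have "s = t \<longleftrightarrow> fst s = fst t" by (simp add: prod_eq_iff)
      moreover have "fst s \<in> lamp_configs V" "fst t \<in> lamp_configs V" "snd s \<in> V"
        using st by (simp_all add: lamp_states_def mem_Times_iff)
      ultimately show ?thesis
        using True V walsh_orthogonal[OF V, of "fst s" "fst t"] by simp
    next
      case False
      then show ?thesis by (auto intro!: sum.neutral)
    qed
    finally show ?thesis .
  qed
  have PQ: "P * Q = 1\<^sub>m N"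
    unfolding P_def Q_def indexed_mat_mult[OF e] indexed_mat_one[OF e, symmetric]
    by (rule indexed_mat_cong[OF e e]) (simp add: walsh2 flip: sum_divide_distrib)
  have QP: "Q * P = 1\<^sub>m N"
    unfolding P_def Q_def indexed_mat_mult[OF e] indexed_mat_one[OF e, symmetric]
    by (rule indexed_mat_cong[OF e e]) (simp add: walsh2 flip: sum_divide_distrib)
  have "A * P = P * B"
    unfolding A P_def B_def indexed_mat_mult[OF e]
  proof (rule indexed_mat_cong[OF e e])
    fix s t assume st: "s \<in> lamp_states V" "t \<in> lamp_states V"
    obtain f v h w where [simp]: "s = (f, v)" "t = (h, w)" by fastforce
    \<comment> \<open>The factor from \<open>P\<close> fixes the position of \<open>r\<close> to be
      \<open>v\<close>, and \<open>walsh_prob\<close> fixes its configuration to be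
      \<open>h\<close>.\<close>
    have "(\<Sum>r\<in>lamp_states V. (if snd s = snd r then walsh V (fst s) (fst r) else 0) *
        walsh_prob V r t) =
      (\<Sum>r\<in>lamp_states V. if r = (h, v) then
         (if v = w then (- 1) ^ h w else 1) / of_nat (card V) * walsh V f h else 0)"
      by (intro sum.cong) (auto simp: walsh_prob_def)
    also have "\<dots> = (if v = w then (- 1) ^ h w else 1) / of_nat (card V) * walsh V f h"
      using st V fin by (subst sum.delta) (auto simp: lamp_states_def)
    also have "\<dots> = (\<Sum>r\<in>lamp_states V. complex_of_real (walk_or_switch_prob V s r) *
        (if snd r = snd t then walsh V (fst r) (fst t) else 0))"
      using walk_or_switch_prob_walsh[OF V, of f v h w] st by (simp only: fst_conv snd_conv \<open>s = _\<close> \<open>t = _\<close>)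
    finally show "(\<Sum>r\<in>lamp_states V. complex_of_real (walk_or_switch_prob V s r) *
        (if snd r = snd t then walsh V (fst r) (fst t) else 0)) =
      (\<Sum>r\<in>lamp_states V. (if snd s = snd r then walsh V (fst s) (fst r) else 0) *
        walsh_prob V r t)" by simp
  qed
  moreover have carr: "{A, B, P, Q} \<subseteq> carrier_mat N N"
    by (simp add: A B_def P_def Q_def)
  ultimately have "A = P * B * Q"
    using PQ by (metis assoc_mult_mat insert_subset right_mult_one_mat)
  with carr PQ QP show ?thesis
    unfolding A_def[symmetric] B_def[symmetric] by (intro similar_matI)
qed

section \<open>The characteristic polynomial as a product over blocks\<close>

definition lit :: "'v set \<Rightarrow> ('v \<Rightarrow> nat) \<Rightarrow> nat" where
  "lit V h = card {v \<in> V. h v = 1}"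

text \<open>The values 0 and \<open>-2/n\<close> of \<open>x\<close> are excluded to keep the
  diagonal part of every block invertible.\<close>

lemma poly_char_poly_walk_or_switch:
  assumes V: "finite V" "V \<noteq> {}" and e: "bij_betw e {..<card (lamp_states V)} (lamp_states V)"
    and x: "x \<noteq> 0" "x + 2 / of_nat (card V) \<noteq> 0"
  defines "n \<equiv> of_nat (card V) :: complex"
  shows "poly (char_poly (walk_or_switch_matrix V e)) x =
    (\<Prod>h\<in>lamp_configs V. x ^ (card V - lit V h) * (x + 2 / n) ^ lit V h *
      (1 - (of_nat (card V - lit V h) / x + of_nat (lit V h) / (x + 2 / n)) / n))"
proof -
  let ?N = "card (lamp_states V)"
  let ?B = "indexed_mat ?N ?N e e (walsh_prob V)"
  let ?l = "\<lambda>h v. if h v = 1 then x + 2 / n else x"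
  have n: "n \<noteq> 0" using V by (simp add: n_def)
  have fin: "finite (lamp_configs V)" using V by (auto intro!: finite_PiE)
  have "poly (char_poly (walk_or_switch_matrix V e)) x = poly (char_poly ?B) x"
    using char_poly_similar[OF walk_or_switch_matrix_similar[OF V(1) e]] by simp
  also have "\<dots> = det (- char_matrix ?B x)"
    by (rule char_poly_matrix) (rule indexed_mat_carrier)
  also have "- char_matrix ?B x = indexed_mat ?N ?N e e
      (\<lambda>s t. (if s = t then x else 0) - walsh_prob V s t)"
    unfolding char_matrix_def indexed_mat_dim indexed_mat_one[OF e, symmetric]
    by (intro eq_matI) auto
  \<comment> \<open>At a lit vertex the diagonal entry of \<open>walsh_prob\<close> is
    \<open>-1/n = 1/n - 2/n\<close>. Moving the \<open>2/n\<close> into the diagonal part leaves a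
    subtracted part equal to \<open>1/n\<close> on each whole block.\<close>
  also have "\<dots> = indexed_mat ?N ?N e e (\<lambda>s t. (if s = t then ?l (fst s) (snd s) else 0)
      - (if fst s = fst t then 1 / n else 0))"
  proof (rule indexed_mat_cong[OF e e])
    fix s t assume "s \<in> lamp_states V" "t \<in> lamp_states V"
    then have "fst s (snd s) \<in> {0, 1}" by (auto simp: lamp_states_def PiE_iff)
    then show "(if s = t then x else 0) - walsh_prob V s t =
      (if s = t then ?l (fst s) (snd s) else 0) - (if fst s = fst t then 1 / n else 0)"
      using n by (auto simp: walsh_prob_def prod_eq_iff n_def field_simps)
  qed
  also have "det \<dots> = (\<Prod>h\<in>lamp_configs V. (\<Prod>v\<in>V. ?l h v) *
      (1 - 1 / n * (\<Sum>v\<in>V. 1 / ?l h v)))"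
    using e[unfolded lamp_states_def] x unfolding lamp_states_def
    by (intro det_diag_minus_const_blocks[OF fin V(1)]) (auto simp: n_def)
  also have "\<dots> = (\<Prod>h\<in>lamp_configs V. x ^ (card V - lit V h) * (x + 2 / n) ^ lit V h *
      (1 - (of_nat (card V - lit V h) / x + of_nat (lit V h) / (x + 2 / n)) / n))"
  proof (rule prod.cong)
    fix h assume "h \<in> lamp_configs V"
    let ?S = "{v \<in> V. h v = 1}"
    have split: "V = ?S \<union> (V - ?S)" "finite ?S" "finite (V - ?S)" "?S \<inter> (V - ?S) = {}"
      using V by auto
    have card: "card (V - ?S) = card V - lit V h"
      using V by (subst card_Diff_subset) (auto simp: lit_def)
    have "(\<Prod>v\<in>V. ?l h v) = (\<Prod>v\<in>?S. ?l h v) * (\<Prod>v\<in>V - ?S. ?l h v)"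
      by (subst split(1)) (rule prod.union_disjoint[OF split(2-)])
    also have "\<dots> = (\<Prod>v\<in>?S. x + 2 / n) * (\<Prod>v\<in>V - ?S. x)"
      by (intro arg_cong2[where f = "(*)"] prod.cong) auto
    finally have 1: "(\<Prod>v\<in>V. ?l h v) = x ^ (card V - lit V h) * (x + 2 / n) ^ lit V h"
      by (simp only: prod_constant card) (simp add: lit_def)
    have "(\<Sum>v\<in>V. 1 / ?l h v) = (\<Sum>v\<in>?S. 1 / ?l h v) + (\<Sum>v\<in>V - ?S. 1 / ?l h v)"
      by (subst split(1)) (rule sum.union_disjoint[OF split(2-)])
    also have "\<dots> = (\<Sum>v\<in>?S. 1 / (x + 2 / n)) + (\<Sum>v\<in>V - ?S. 1 / x)"
      by (intro arg_cong2[where f = "(+)"] sum.cong) auto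
    finally have 2: "(\<Sum>v\<in>V. 1 / ?l h v) =
        of_nat (card V - lit V h) / x + of_nat (lit V h) / (x + 2 / n)"
      by (simp only: sum_constant card) (simp add: lit_def)
    show "(\<Prod>v\<in>V. ?l h v) * (1 - 1 / n * (\<Sum>v\<in>V. 1 / ?l h v)) =
      x ^ (card V - lit V h) * (x + 2 / n) ^ lit V h *
      (1 - (of_nat (card V - lit V h) / x + of_nat (lit V h) / (x + 2 / n)) / n)"
      unfolding 1 2 by simp
  qed simp
  finally show ?thesis .
qed

section \<open>Roots of a single block\<close>

text \<open>Clearing denominators costs one factor \<open>x\<close> if \<open>k < n\<close> and one
  factor \<open>x + 2/n\<close> if \<open>k > 0\<close>. What remains is linear for
  \<open>k = 0\<close> and \<open>k = n\<close>, and quadratic in between.\<close>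

lemma Sigma_mset_linear_factors:
  fixes x :: complex
  assumes n: "n \<ge> 2" and k: "k \<le> n" and x: "x \<noteq> 0" "x + 2 / of_nat n \<noteq> 0"
  shows "x ^ (n - k) * (x + 2 / of_nat n) ^ k *
      (1 - (of_nat (n - k) / x + of_nat k / (x + 2 / of_nat n)) / of_nat n) =
    (\<Prod>a\<in>#Sigma_mset n k. x - of_real a)"
proof -
  define N where "N = (of_nat n :: complex)"
  have N: "N \<noteq> 0" using n by (simp add: N_def)
  define y where "y = x + 2 / N"
  have y: "y \<noteq> 0" using x by (simp add: y_def N_def)
  consider "k = 0" | "k = n" | "0 < k" "k < n" using k by linarith
  then show ?thesis
  proof cases
    case 1
    have "x ^ n = x ^ (n - 1) * x" using n by (simp flip: power_Suc2)
    with 1 x N show ?thesis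
      by (simp add: Sigma_mset_def N_def[symmetric] field_simps)
  next
    case 2
    have "y ^ n = y ^ (n - 1) * y" using n by (simp flip: power_Suc2)
    then have "y ^ n * (1 - 1 / y) = y ^ (n - 1) * (y - 1)" using y by (simp add: field_simps)
    moreover have "y - 1 = x - (N - 2) / N" using N by (simp add: y_def field_simps)
    ultimately show ?thesis using 2 n N
      by (simp add: Sigma_mset_def N_def[symmetric] y_def[symmetric])
  next
    case 3
    define d where "d = complex_of_real (sqrt ((real n + 2)\<^sup>2 - 8 * real k))"
    define K where "K = (of_nat k :: complex)"
    \<comment> \<open>The radicand is nonnegative because
      \<open>(n + 2)^2 - 8 * n = (n - 2)^2\<close>, so the real square root really squares to
      it.\<close>
    have "8 * real k \<le> 8 * real n" using k by simp
    also have "\<dots> \<le> (real n + 2)\<^sup>2" using zero_le_power2[of "real n - 2"]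
      by (simp add: power2_eq_square algebra_simps)
    finally have "(sqrt ((real n + 2)\<^sup>2 - 8 * real k))\<^sup>2 = (real n + 2)\<^sup>2 - 8 * real k" by simp
    from arg_cong[OF this, of complex_of_real] have d: "d\<^sup>2 = (N + 2)\<^sup>2 - 8 * K"
      by (simp only: d_def N_def K_def of_real_power of_real_diff of_real_add of_real_mult
          of_real_numeral of_real_of_nat_eq)
    have xy: "x ^ (n - k) = x ^ (n - k - 1) * x" "y ^ k = y ^ (k - 1) * y"
      using 3 by (simp_all only: power_minus_mult zero_less_diff)
    have nk: "of_nat (n - k) = N - K" using 3 by (simp add: N_def K_def of_nat_diff)
    have "x * y * (1 - ((N - K) / x + K / y) / N) = x * y - ((N - K) * y + K * x) / N"
      using x y N by (simp add: field_simps)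
    also have "\<dots> = x\<^sup>2 - (N - 2) / N * x - 2 * (N - K) / N\<^sup>2"
      using N by (simp add: y_def field_simps power2_eq_square)
    \<comment> \<open>Completing the square: \<open>(N - 2)^2 - d^2 = -8 * (N - K)\<close>.\<close>
    also have "\<dots> = (x - (N - 2) / (2 * N))\<^sup>2 - d\<^sup>2 / (2 * N)\<^sup>2"
      unfolding d using N by (simp add: field_simps power2_eq_square)
    also have "\<dots> = (x - (N - 2 + d) / (2 * N)) * (x - (N - 2 - d) / (2 * N))"
      by (simp add: power2_eq_square add_divide_distrib diff_divide_distrib algebra_simps)
    finally have quad: "x * y * (1 - ((N - K) / x + K / y) / N) =
      (x - (N - 2 + d) / (2 * N)) * (x - (N - 2 - d) / (2 * N))" .
    have "x ^ (n - k) * y ^ k * (1 - ((N - K) / x + K / y) / N) =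
      y ^ (k - 1) * x ^ (n - k - 1) * (x * y * (1 - ((N - K) / x + K / y) / N))"
      unfolding xy by (simp only: mult_ac)
    also note quad
    finally have "x ^ (n - k) * y ^ k * (1 - ((N - K) / x + K / y) / N) =
      y ^ (k - 1) * x ^ (n - k - 1) *
        ((x - (N - 2 + d) / (2 * N)) * (x - (N - 2 - d) / (2 * N)))" .
    then show ?thesis using 3
      by (simp add: Sigma_mset_def nk N_def[symmetric] y_def[symmetric] d_def[symmetric]
          K_def[symmetric])
  qed
qed

section \<open>Multiplicities and the spectrum\<close>

text \<open>A nonzero difference would have finitely many roots, yet the complement of a finite set
  is infinite here. This removes the restriction on \<open>x\<close> in the evaluation of the
  characteristic polynomial.\<close>

lemma poly_eq_if_eq_off_finite:
  fixes p q :: "'a :: {idom, ring_char_0} poly"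
  assumes "finite S" and "\<And>x. x \<notin> S \<Longrightarrow> poly p x = poly q x"
  shows "p = q"
proof (rule ccontr)
  assume "p \<noteq> q"
  then have "finite {x. poly (p - q) x = 0}" by (intro poly_roots_finite) simp
  moreover have "- S \<subseteq> {x. poly (p - q) x = 0}" using assms(2) by auto
  ultimately have "finite (- S)" by (rule finite_subset[rotated])
  with assms(1) show False using infinite_UNIV_char_0[where 'a = 'a] by (metis finite_compl)
qed

lemma card_lamp_configs_lit:
  assumes "finite V"
  shows "card {h \<in> lamp_configs V. lit V h = k} = card V choose k"
proof -
  have "bij_betw (\<lambda>h. {v \<in> V. h v = 1}) {h \<in> lamp_configs V. lit V h = k}
      {S. S \<subseteq> V \<and> card S = k}"
  \<comment> \<open>The inverse is the indicator function restricted to \<open>V\<close>, since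
    configurations are extensional and must be \<open>undefined\<close> outside
    \<open>V\<close>.\<close>
  proof (rule bij_betw_byWitness[where f' = "\<lambda>S. \<lambda>v\<in>V. if v \<in> S then 1 else 0"])
    show "\<forall>h\<in>{h \<in> lamp_configs V. lit V h = k}.
        (\<lambda>v\<in>V. if v \<in> {v \<in> V. h v = 1} then 1 else 0) = h"
      by (fastforce simp: PiE_iff extensional_def fun_eq_iff)
    show "\<forall>S\<in>{S. S \<subseteq> V \<and> card S = k}.
        {v \<in> V. (\<lambda>v\<in>V. if v \<in> S then 1 else 0) v = (1 :: nat)} = S"
      by (auto split: if_splits)
    have "lit V (\<lambda>v\<in>V. if v \<in> S then 1 else 0) = card S" if "S \<subseteq> V" for S
      unfolding lit_def using that by (intro arg_cong[where f = card]) (auto split: if_splits)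
    then show "(\<lambda>S. \<lambda>v\<in>V. if v \<in> S then 1 else 0) ` {S. S \<subseteq> V \<and> card S = k}
        \<subseteq> {h \<in> lamp_configs V. lit V h = k}"
      by (auto split: if_splits)
  qed (auto simp: lit_def)
  then show ?thesis
    using n_subsets[OF assms] by (simp add: bij_betw_same_card)
qed

lemma image_mset_sum: "image_mset f (\<Sum>x\<in>A. M x) = (\<Sum>x\<in>A. image_mset f (M x))"
  by (induction A rule: infinite_finite_induct) auto

lemma sum_mset_constant: "(\<Sum>x\<in>A. M) = repeat_mset (card A) M"
  by (induction A rule: infinite_finite_induct) auto

text \<open>Grouping the blocks by their number of lit lamps is what produces the binomial
  multiplicities.\<close>

lemma sum_lamp_configs_lit:
  fixes F :: "nat \<Rightarrow> 'a multiset"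
  assumes V: "finite V"
  shows "(\<Sum>h\<in>lamp_configs V. F (lit V h)) =
    (\<Sum>k=0..card V. repeat_mset (card V choose k) (F k))"
proof -
  have "finite (lamp_configs V)" using V by (auto intro!: finite_PiE)
  moreover have "lit V ` lamp_configs V \<subseteq> {0..card V}"
    using V by (auto simp: lit_def intro!: card_mono)
  ultimately have "(\<Sum>h\<in>lamp_configs V. F (lit V h)) =
      (\<Sum>k=0..card V. \<Sum>h\<in>{h \<in> lamp_configs V. lit V h = k}. F (lit V h))"
    by (intro sum.group[symmetric]) auto
  also have "\<dots> = (\<Sum>k=0..card V. \<Sum>h\<in>{h \<in> lamp_configs V. lit V h = k}. F k)"
    by (intro sum.cong) auto
  finally show ?thesis by (simp only: sum_mset_constant card_lamp_configs_lit[OF V])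
qed

lemma proots_prod_mset_linear: "proots (\<Prod>a\<in>#M. [:- f a, 1:]) = image_mset f M"
proof (induction M)
  case (add a M)
  have "(\<Prod>a\<in>#M. [:- f a, 1:]) \<noteq> 0" by (auto simp: prod_mset_zero_iff)
  with add show ?case by (simp add: proots_mult del: mult_pCons_left)
qed simp

theorem theorem5p6:
  fixes V :: "'v set" and n :: nat and e :: "nat \<Rightarrow> 'v lamp_state"
  assumes "finite V" and "card V = n" and "n \<ge> 2"
    and "bij_betw e {..<card (lamp_states V)} (lamp_states V)"
  shows "spectrum_mset (walk_or_switch_matrix V e) =
    image_mset complex_of_real (\<Sum>k=0..n. repeat_mset (n choose k) (Sigma_mset n k))"
proof -
  have V: "V \<noteq> {}" using assms by auto
  let ?p = "\<lambda>h. \<Prod>a\<in>#Sigma_mset n (lit V h). [:- complex_of_real a, 1:]"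
  have "char_poly (walk_or_switch_matrix V e) = (\<Prod>h\<in>lamp_configs V. ?p h)"
  \<comment> \<open>The finite exceptional set consists of the two points where the block
    determinants were not evaluated.\<close>
  proof (rule poly_eq_if_eq_off_finite[of "{0, - 2 / of_nat n}"])
    fix x :: complex assume "x \<notin> {0, - 2 / of_nat n}"
    then have x: "x \<noteq> 0" "x + 2 / of_nat n \<noteq> 0" by (auto simp: add_eq_0_iff2)
    have "lit V h \<le> n" for h
      using assms(1,2) by (auto simp: lit_def intro!: card_mono)
    moreover have "poly (?p h) x = (\<Prod>a\<in>#Sigma_mset n (lit V h). x - of_real a)" for h
      by (simp add: poly_prod_mset image_mset.compositionality o_def)
    ultimately show "poly (char_poly (walk_or_switch_matrix V e)) x =
        poly (\<Prod>h\<in>lamp_configs V. ?p h) x"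
      using poly_char_poly_walk_or_switch[OF assms(1) V assms(4), of x] x assms(2)
      by (simp add: poly_prod Sigma_mset_linear_factors[OF assms(3)] del: of_nat_diff)
  qed simp
  \<comment> \<open>A product of linear factors is nonzero, so \<open>proots\<close> turns the
    product over configurations into a sum of multisets.\<close>
  then have "spectrum_mset (walk_or_switch_matrix V e) = (\<Sum>h\<in>lamp_configs V. proots (?p h))"
    unfolding spectrum_mset_def by (simp only:) (rule proots_prod, auto simp: prod_mset_zero_iff)
  also have "\<dots> = (\<Sum>h\<in>lamp_configs V. image_mset complex_of_real (Sigma_mset n (lit V h)))"
    by (simp only: proots_prod_mset_linear)
  also have "\<dots> = image_mset complex_of_real (\<Sum>h\<in>lamp_configs V. Sigma_mset n (lit V h))"
    by (rule image_mset_sum[symmetric])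
  also have "(\<Sum>h\<in>lamp_configs V. Sigma_mset n (lit V h)) =
      (\<Sum>k=0..n. repeat_mset (n choose k) (Sigma_mset n k))"
    using sum_lamp_configs_lit[OF assms(1), of "Sigma_mset n"] assms(2) by simp
  finally show ?thesis .
qed

end
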